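(* The boundary of any bounded Lipschitz domain $U\subset\mathbb{R}^n$ is a deformable Lipschitz boundary.
   Context: A domain is a connected open set. For an open set $U\subset\mathbb{R}^n$, $\partial U$ is a deformable Lipschitz boundary if: (i) for each $x\in\partial U$ there exist $r>0$ and a Lipschitz map $\gamma:\mathbb{R}^{n-1}\to\mathbb{R}$ such that, upon rotating and relabeling the coordinate axes if necessary, $U\cap Q(x,r)=\{y\in\mathbb{R}^n: y_n>\gamma(y_1,\dots,y_{n-1})\}\cap Q(x,r)$, where $Q(x,r)=\{y\in\mathbb{R}^n:|y_i-x_i|\le r,\ i=1,\dots,n\}$; (ii) there exists a map $\Psi:\partial U\times[0,1]\to\overline U$ such that $\Psi$ is a bi-Lipschitz homeomorphism over its image and $\Psi(\cdot,0)=\mathrm{Id}$ on $\partial U$; here one denotes $\partial U_\tau=\Psi(\partial U\times\{\tau\})$ for $\tau\in(0,1]$ and by $U_\tau$ the open subset of $U$ whose boundary is $\partial U_\tau$. Such a $\Psi$ is called a Lipschitz deformation of $\partial U$. A Lipschitz domain is a domain satisfying (i). *)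

theory Defs
  imports "HOL-Analysis.Analysis"
begin

definition cube :: "real ^ 'n \<Rightarrow> real \<Rightarrow> (real ^ 'n) set" where
  "cube x r = {y. \<forall>i. \<bar>y $ i - x $ i\<bar> \<le> r}"

text \<open>
  The space \<open>\<real>\<^sup>n\<^sup>-\<^sup>1\<close> of the coordinates other than the \<open>k\<close>-th one is identified isometrically with
  the coordinate hyperplane \<open>{z. z $ k = 0}\<close>; this also covers \<open>n = 1\<close>, where it is a point.
\<close>

definition coord_hyperplane :: "'n \<Rightarrow> (real ^ 'n) set" where
  "coord_hyperplane k = {z. z $ k = 0}"

definition omit_coord :: "'n \<Rightarrow> real ^ 'n \<Rightarrow> real ^ 'n" where
  "omit_coord k y = (\<chi> i. if i = k then 0 else y $ i)"

text \<open>
  The map \<open>T\<close> passes to the rotated coordinates, in which both the cube and the graph are taken;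
  the index \<open>k\<close> is the one relabelled as the last. Rotations and relabellings of the axes
  together give all orthogonal transformations (for \<open>n = 1\<close>: the axis may be reversed).
\<close>

definition lipschitz_boundary :: "(real ^ 'n) set \<Rightarrow> bool" where
  "lipschitz_boundary U \<longleftrightarrow>
     (\<forall>x \<in> frontier U. \<exists>r > 0.
        \<exists>(T :: real ^ 'n \<Rightarrow> real ^ 'n) (k :: 'n) (\<gamma> :: real ^ 'n \<Rightarrow> real) L.
        orthogonal_transformation T \<and>
        L-lipschitz_on (coord_hyperplane k) \<gamma> \<and>
        T ` U \<inter> cube (T x) r = {y. y $ k > \<gamma> (omit_coord k y)} \<inter> cube (T x) r)"

definition bi_lipschitz_embedding_on ::
    "'a::metric_space set \<Rightarrow> ('a \<Rightarrow> 'b::metric_space) \<Rightarrow> bool" where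
  "bi_lipschitz_embedding_on S f \<longleftrightarrow>
     (\<exists>g L M. homeomorphism S (f ` S) f g \<and> L-lipschitz_on S f \<and> M-lipschitz_on (f ` S) g)"

definition lipschitz_deformation ::
    "(real ^ 'n) set \<Rightarrow> ((real ^ 'n) \<times> real \<Rightarrow> real ^ 'n) \<Rightarrow> bool" where
  "lipschitz_deformation U \<Psi> \<longleftrightarrow>
     \<Psi> \<in> frontier U \<times> {0..1} \<rightarrow> closure U \<and>
     bi_lipschitz_embedding_on (frontier U \<times> {0..1}) \<Psi> \<and>
     (\<forall>x \<in> frontier U. \<Psi> (x, 0) = x)"

text \<open>Stated for an open set \<open>U\<close>, as a property of \<open>U\<close> rather than of the bare set \<open>frontier U\<close>.\<close>

definition deformable_lipschitz_boundary :: "(real ^ 'n) set \<Rightarrow> bool" where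
  "deformable_lipschitz_boundary U \<longleftrightarrow>
     lipschitz_boundary U \<and> (\<exists>\<Psi>. lipschitz_deformation U \<Psi>)"

definition lipschitz_domain :: "(real ^ 'n) set \<Rightarrow> bool" where
  "lipschitz_domain U \<longleftrightarrow> open U \<and> connected U \<and> lipschitz_boundary U"

end

theory Submission
  imports Defs
begin

text \<open>
  In each chart the upward direction \<open>v\<close> spans an open cone of inward directions: translating a point
  of \<open>closure U\<close> near the chart's centre by a short vector of this cone leads into \<open>U\<close>. Composing
  such translations shows that nonnegative combinations of inward directions are again inward, so
  the charts' directions can be glued, with Lipschitz weights, to one Lipschitz field \<open>V\<close> that is
  uniformly inward on the compact set \<open>frontier U\<close>. The deformation is \<open>\<Psi> (x, t) = x + \<epsilon> t V x\<close> with a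
  small \<open>\<epsilon>\<close>. Since \<open>U\<close> is open, no boundary point \<open>y\<close> lies in the inward cone at \<open>x\<close>, so
  \<open>norm (x + \<tau> V x - y) \<ge> \<delta> \<tau>\<close>; this gives the lower Lipschitz bound.
\<close>

section \<open>Inward directions and their nonnegative combinations\<close>

text \<open>Base points range over a whole neighbourhood of \<open>p\<close>, so that translations
  can be composed, and over \<open>closure U\<close>, so that boundary points may start them. The
  single radius \<open>\<rho>\<close> limits both the base point and the step length.\<close>

definition inward_at :: "'a::real_normed_vector set \<Rightarrow> 'a \<Rightarrow> 'a \<Rightarrow> real \<Rightarrow> real \<Rightarrow> bool" where
  "inward_at U p v \<delta> \<rho> \<longleftrightarrow>
     (\<forall>z\<in>closure U. \<forall>t w. dist z p < \<rho> \<longrightarrow> 0 < t \<longrightarrow> t < \<rho> \<longrightarrow> norm (w - v) < \<delta> \<longrightarrow> z + t *\<^sub>R w \<in> U)"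

lemma inward_atD:
  assumes "inward_at U p v \<delta> \<rho>" "z \<in> closure U" "dist z p < \<rho>" "0 < t" "t < \<rho>" "norm (w - v) < \<delta>"
  shows "z + t *\<^sub>R w \<in> U"
  using assms unfolding inward_at_def by blast

text \<open>Base points in \<open>U\<close> suffice: approximate \<open>z\<close> by
  \<open>z'\<close> in \<open>U\<close> and absorb the error into the direction, replacing
  \<open>w\<close> by \<open>w + (z - z') / t\<close>. The strict bound on
  \<open>norm (w - v)\<close> leaves room for this.\<close>

lemma inward_atI:
  fixes U :: "'a::real_normed_vector set"
  assumes U: "\<And>z t w. \<lbrakk>z \<in> U; dist z p < \<rho>; 0 < t; t < \<rho>; norm (w - v) < \<delta>\<rbrakk> \<Longrightarrow> z + t *\<^sub>R w \<in> U"
  shows "inward_at U p v \<delta> \<rho>"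
  unfolding inward_at_def
proof (intro ballI allI impI)
  fix z t w
  assume z: "z \<in> closure U" "dist z p < \<rho>" and t: "0 < t" "t < \<rho>" and w: "norm (w - v) < \<delta>"
  \<comment> \<open>The first bound keeps \<open>z'\<close> within \<open>\<rho>\<close> of
    \<open>p\<close>, the second keeps the corrected direction within \<open>\<delta>\<close> of
    \<open>v\<close>.\<close>
  define e where "e = min (\<rho> - dist z p) (t * (\<delta> - norm (w - v)))"
  have "e > 0" using z t w by (simp add: e_def)
  then obtain z' where z': "z' \<in> U" "dist z' z < e"
    using z(1) closure_approachable by blast
  define w' where "w' = w + (1 / t) *\<^sub>R (z - z')"
  have "dist z' p < \<rho>"
    using z'(2) dist_triangle[of z' p z] by (simp add: e_def)
  moreover have "norm (w' - v) < \<delta>"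
  proof -
    have "norm (z - z') < t * (\<delta> - norm (w - v))"
      using z'(2) by (simp add: e_def dist_norm norm_minus_commute)
    then have "norm ((1 / t) *\<^sub>R (z - z')) < \<delta> - norm (w - v)"
      unfolding norm_scaleR using t by (simp add: field_simps)
    moreover have "norm (w' - v) \<le> norm (w - v) + norm ((1 / t) *\<^sub>R (z - z'))"
      using norm_triangle_ineq[of "w - v" "(1 / t) *\<^sub>R (z - z')"] by (simp add: w'_def algebra_simps)
    ultimately show ?thesis by linarith
  qed
  ultimately have "z' + t *\<^sub>R w' \<in> U" using U z'(1) t by blast
  moreover have "z' + t *\<^sub>R w' = z + t *\<^sub>R w" using t by (simp add: w'_def algebra_simps)
  ultimately show "z + t *\<^sub>R w \<in> U" by simp
qed

text \<open>The translations by \<open>a i *\<^sub>R w i\<close> are performed one after another.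
  The sum of \<open>a j * (1 + norm (w j))\<close> dominates every step length and every
  intermediate displacement at once. An index of weight zero causes no motion, so \<open>z\<close>
  need not be close to its centre.\<close>

lemma inward_at_sum:
  fixes U :: "'a::real_normed_vector set"
  assumes "finite I" "z \<in> closure U"
    and "\<And>i. i \<in> I \<Longrightarrow> inward_at U (p i) (v i) (\<delta> i) (\<rho> i)"
    and "\<And>i. i \<in> I \<Longrightarrow> 0 \<le> a i"
    and "\<And>i. i \<in> I \<Longrightarrow> norm (w i - v i) < \<delta> i"
    and "\<And>i. i \<in> I \<Longrightarrow> 0 < a i \<Longrightarrow> dist z (p i) + (\<Sum>j\<in>I. a j * (1 + norm (w j))) < \<rho> i"
  shows "z + (\<Sum>i\<in>I. a i *\<^sub>R w i) \<in> closure U \<and>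
         ((\<exists>i\<in>I. 0 < a i) \<longrightarrow> z + (\<Sum>i\<in>I. a i *\<^sub>R w i) \<in> U)"
  using assms
proof (induction I rule: finite_induct)
  case empty
  then show ?case by simp
next
  case (insert k I)
  define S where "S = (\<Sum>j\<in>I. a j * (1 + norm (w j)))"
  define z' where "z' = z + (\<Sum>i\<in>I. a i *\<^sub>R w i)"
  have nn: "0 \<le> S" unfolding S_def using insert.prems(3) by (auto intro!: sum_nonneg)
  have ak: "0 \<le> a k" using insert.prems(3) by simp
  have eq: "(\<Sum>j\<in>insert k I. a j * (1 + norm (w j))) = a k + a k * norm (w k) + S"
    using insert.hyps by (simp add: S_def algebra_simps)
  have akw: "0 \<le> a k * norm (w k)" using ak by simp
  have IH: "z' \<in> closure U \<and> ((\<exists>i\<in>I. 0 < a i) \<longrightarrow> z' \<in> U)"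
    unfolding z'_def
  proof (rule insert.IH)
    fix i assume i: "i \<in> I" "0 < a i"
    show "dist z (p i) + (\<Sum>j\<in>I. a j * (1 + norm (w j))) < \<rho> i"
      using insert.prems(5)[of i, OF insertI2[OF i(1)] i(2)] eq ak akw unfolding S_def by linarith
  qed (use insert.prems in auto)
  have new: "z + (\<Sum>i\<in>insert k I. a i *\<^sub>R w i) = z' + a k *\<^sub>R w k"
    using insert.hyps by (simp add: z'_def)
  show ?case
  proof (cases "a k = 0")
    case True
    then show ?thesis unfolding new using IH by auto
  next
    case False
    then have pos: "0 < a k" using ak by simp
    have lt: "dist z (p k) + (a k + a k * norm (w k) + S) < \<rho> k"
      using insert.prems(5)[of k] pos eq by simp
    have "norm (\<Sum>i\<in>I. a i *\<^sub>R w i) \<le> S"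
      unfolding S_def using insert.prems(3)
      by (intro sum_norm_le) (simp add: algebra_simps)
    then have "dist z' z \<le> S" by (simp add: z'_def dist_norm)
    then have "dist z' (p k) < \<rho> k"
      using dist_triangle[of z' "p k" z] lt akw pos by linarith
    moreover have "a k < \<rho> k"
      using lt akw nn zero_le_dist[of z "p k"] by linarith
    \<comment> \<open>Even if \<open>z'\<close> lies only in the closure, one step of positive
      length leads into \<open>U\<close>.\<close>
    ultimately have "z' + a k *\<^sub>R w k \<in> U"
      using inward_atD[of U "p k" "v k" "\<delta> k" "\<rho> k"] IH pos insert.prems(2,4) by blast
    then show ?thesis unfolding new using closure_subset by blast
  qed
qed

lemma finite_positive_lower_bound:
  fixes f :: "'a \<Rightarrow> real"
  assumes "finite I" "\<And>i. i \<in> I \<Longrightarrow> 0 < f i"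
  obtains d where "0 < d" "\<And>i. i \<in> I \<Longrightarrow> d \<le> f i"
proof
  show "0 < Min (insert 1 (f ` I))" using assms by simp
  show "\<And>i. i \<in> I \<Longrightarrow> Min (insert 1 (f ` I)) \<le> f i" using assms by simp
qed

section \<open>Gluing local inward directions to a Lipschitz field\<close>

text \<open>A finite cover of \<open>K\<close> and tent-shaped weights combine the local directions.
  The weights are not normalised: a positive lower bound \<open>c\<close> on their sum is enough,
  and it yields the uniform aperture \<open>c * d0\<close>.\<close>

lemma inward_field_exists:
  fixes U :: "'a::real_normed_vector set"
  assumes K: "compact K" "K \<subseteq> closure U"
    and loc: "\<And>p. p \<in> K \<Longrightarrow> \<exists>v \<delta> \<rho>. 0 < \<delta> \<and> 0 < \<rho> \<and> inward_at U p v \<delta> \<rho>"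
  obtains V L M \<delta> \<rho> where "L-lipschitz_on K V" "\<And>x. x \<in> K \<Longrightarrow> norm (V x) \<le> M"
    "0 < \<delta>" "0 < \<rho>"
    "\<And>x t w. \<lbrakk>x \<in> K; 0 < t; t < \<rho>; norm (w - V x) < \<delta>\<rbrakk> \<Longrightarrow> x + t *\<^sub>R w \<in> U"
proof -
  obtain v d r where vdr: "\<And>p. p \<in> K \<Longrightarrow> 0 < d p \<and> 0 < r p \<and> inward_at U p (v p) (d p) (r p)"
    using loc by metis
  \<comment> \<open>Quarter balls cover while the weights below live on half balls: some weight is
    then at least \<open>r p / 4\<close>, and wherever a weight is positive half of
    \<open>r p\<close> remains for the displacement.\<close>
  have "K \<subseteq> (\<Union>p\<in>K. ball p (r p / 4))" using vdr by fastforce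
  then obtain I where I: "I \<subseteq> K" "finite I" "K \<subseteq> (\<Union>p\<in>I. ball p (r p / 4))"
    using compactE_image[OF K(1), of K "\<lambda>p. ball p (r p / 4)"] by auto
  obtain d0 where d0: "0 < d0" "\<And>p. p \<in> I \<Longrightarrow> d0 \<le> d p"
    using finite_positive_lower_bound[of I d] I vdr by blast
  obtain r0 where r0: "0 < r0" "\<And>p. p \<in> I \<Longrightarrow> r0 \<le> r p"
    using finite_positive_lower_bound[of I r] I vdr by blast
  define \<phi> where "\<phi> p x = max 0 (r p / 2 - dist x p)" for p x
  define V where "V x = (\<Sum>p\<in>I. \<phi> p x *\<^sub>R v p)" for x
  define c where "c = r0 / 4"
  have c: "0 < c" using r0 by (simp add: c_def)
  have phi0: "0 \<le> \<phi> p x" for p x by (simp add: \<phi>_def)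
  have phi_le: "\<phi> p x \<le> r p / 2" if "p \<in> I" for p x
  proof -
    have "0 < r p" using that vdr I(1) by blast
    then show ?thesis using zero_le_dist[of x p] unfolding \<phi>_def by linarith
  qed
  have phi_lip: "\<bar>\<phi> p x - \<phi> p y\<bar> \<le> dist x y" for p x y
    using dist_triangle[of x p y] dist_triangle[of y p x] by (simp add: \<phi>_def dist_commute)
  have total: "c \<le> (\<Sum>p\<in>I. \<phi> p x)" if x: "x \<in> K" for x
  proof -
    obtain p where p: "p \<in> I" "dist p x < r p / 4" using I(3) x by auto
    have "c \<le> \<phi> p x" using p r0(2)[OF p(1)] unfolding \<phi>_def c_def dist_commute[of x p] by linarith
    also have "\<dots> \<le> (\<Sum>p\<in>I. \<phi> p x)" using p(1) I(2) phi0 by (intro member_le_sum) auto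
    finally show ?thesis .
  qed
  \<comment> \<open>\<open>B\<close> bounds the cost in \<open>inward_at_sum\<close> per unit of
    \<open>t\<close>, for all perturbed directions within \<open>d p\<close> of
    \<open>v p\<close>.\<close>
  define B where "B = (\<Sum>p\<in>I. r p / 2 * (1 + (norm (v p) + d p)))"
  have B0: "0 \<le> B" unfolding B_def using vdr I(1)
    by (intro sum_nonneg mult_nonneg_nonneg) (force intro: add_nonneg_nonneg less_imp_le)+
  \<comment> \<open>This makes the total cost less than \<open>r0 / 2\<close>; \<open>B + 1\<close>
    keeps the denominator positive.\<close>
  define \<rho> where "\<rho> = r0 / (2 * (B + 1))"
  show thesis
  proof (rule that)
    show "(\<Sum>p\<in>I. norm (v p))-lipschitz_on K V"
    proof (rule lipschitz_onI)
      fix x y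
      have "dist (V x) (V y) = norm (\<Sum>p\<in>I. (\<phi> p x - \<phi> p y) *\<^sub>R v p)"
        by (simp add: V_def dist_norm sum_subtractf scaleR_left_diff_distrib)
      also have "\<dots> \<le> (\<Sum>p\<in>I. norm (v p) * dist x y)"
        by (intro sum_norm_le) (simp add: phi_lip mult_left_mono mult.commute[of "\<bar>_\<bar>"])
      finally show "dist (V x) (V y) \<le> (\<Sum>p\<in>I. norm (v p)) * dist x y"
        by (simp add: sum_distrib_right)
    qed (simp add: sum_nonneg)
    show "norm (V x) \<le> (\<Sum>p\<in>I. r p / 2 * norm (v p))" if "x \<in> K" for x
      unfolding V_def
      by (intro sum_norm_le) (simp add: phi0 mult_right_mono[OF phi_le, simplified])
    show "0 < c * d0" using c d0 by simp
    show "0 < \<rho>" using r0 B0 by (simp add: \<rho>_def)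
    fix x t w assume x: "x \<in> K" and t: "0 < t" "t < \<rho>" and w: "norm (w - V x) < c * d0"
    define A where "A = (\<Sum>p\<in>I. \<phi> p x)"
    have A: "c \<le> A" "0 < A" using total[OF x] c by (auto simp: A_def)
    \<comment> \<open>The perturbation \<open>w - V x\<close> is distributed equally over the local
      directions; after division by the total weight \<open>A\<close>, the weighted sum of the
      \<open>u p\<close> is exactly \<open>w\<close>.\<close>
    define u where "u p = v p + (1 / A) *\<^sub>R (w - V x)" for p
    have u: "norm (u p - v p) < d p" if "p \<in> I" for p
    proof -
      have "norm (u p - v p) = norm (w - V x) / A" using A by (simp add: u_def)
      also have "\<dots> < d0"
      proof -
        have "c * d0 \<le> A * d0" using A d0 by simp
        then show ?thesis using w A by (simp add: field_simps)
      qed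
      finally show ?thesis using d0(2)[OF that] by simp
    qed
    have sumw: "(\<Sum>p\<in>I. (t * \<phi> p x) *\<^sub>R u p) = t *\<^sub>R w"
    proof -
      have "(\<Sum>p\<in>I. \<phi> p x *\<^sub>R u p) = V x + A *\<^sub>R ((1 / A) *\<^sub>R (w - V x))"
        by (simp only: u_def scaleR_right_distrib sum.distrib V_def A_def scaleR_sum_left)
      also have "\<dots> = w" using A by simp
      finally have "t *\<^sub>R (\<Sum>p\<in>I. \<phi> p x *\<^sub>R u p) = t *\<^sub>R w" by simp
      then show ?thesis by (simp add: scaleR_sum_right)
    qed
    have small: "(\<Sum>p\<in>I. t * \<phi> p x * (1 + norm (u p))) < r0 / 2"
    proof -
      have "(\<Sum>p\<in>I. \<phi> p x * (1 + norm (u p))) \<le> B"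
        unfolding B_def
      proof (intro sum_mono mult_mono)
        fix p assume p: "p \<in> I"
        show "1 + norm (u p) \<le> 1 + (norm (v p) + d p)"
          using u[OF p] norm_triangle_sub[of "u p" "v p"] by simp
        show "\<phi> p x \<le> r p / 2" "0 \<le> r p / 2"
          using phi_le[OF p, of x] phi0[of p x] by linarith+
      qed simp
      then have "t * (\<Sum>p\<in>I. \<phi> p x * (1 + norm (u p))) \<le> t * B" using t by simp
      also have "\<dots> \<le> \<rho> * B" using t B0 by (simp add: mult_right_mono)
      also have "\<dots> < r0 / 2" using B0 r0 by (simp add: \<rho>_def field_simps)
      finally show ?thesis by (simp add: sum_distrib_left mult.assoc)
    qed
    have "x + (\<Sum>p\<in>I. (t * \<phi> p x) *\<^sub>R u p) \<in> closure U \<and>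
        ((\<exists>p\<in>I. 0 < t * \<phi> p x) \<longrightarrow> x + (\<Sum>p\<in>I. (t * \<phi> p x) *\<^sub>R u p) \<in> U)"
    proof (rule inward_at_sum[where p = "\<lambda>p. p" and v = v and \<delta> = d and \<rho> = r])
      show "x \<in> closure U" using x K by blast
      fix p assume p: "p \<in> I"
      show "inward_at U p (v p) (d p) (r p)" using vdr p I by blast
      show "0 \<le> t * \<phi> p x" using t phi0 by simp
      assume "0 < t * \<phi> p x"
      then have "dist x p < r p / 2" using t by (auto simp: \<phi>_def zero_less_mult_iff max_def split: if_splits)
      then show "dist x p + (\<Sum>q\<in>I. t * \<phi> q x * (1 + norm (u q))) < r p"
        using small r0(2)[OF p] by linarith
    qed (use I u in auto)
    moreover have "\<exists>p\<in>I. 0 < t * \<phi> p x"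
    proof (rule ccontr)
      assume "\<not> ?thesis"
      then have "\<phi> p x = 0" if "p \<in> I" for p
        using that phi0[of p x] t by (metis mult_pos_pos order_le_less)
      then show False using A by (simp add: A_def)
    qed
    ultimately show "x + t *\<^sub>R w \<in> U" by (simp add: sumw)
  qed
qed

section \<open>Bi-Lipschitz estimates for pushing along a field\<close>

lemma bi_lipschitz_embedding_onI:
  assumes L: "L-lipschitz_on S f" and C: "0 \<le> C"
    and lower: "\<And>a b. a \<in> S \<Longrightarrow> b \<in> S \<Longrightarrow> dist a b \<le> C * dist (f a) (f b)"
  shows "bi_lipschitz_embedding_on S f"
proof -
  have inj: "inj_on f S"
  proof (rule inj_onI)
    fix a b assume "a \<in> S" "b \<in> S" "f a = f b"
    then show "a = b" using lower[of a b] by simp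
  qed
  let ?g = "inv_into S f"
  have g: "C-lipschitz_on (f ` S) ?g"
    using lower C inj by (auto intro!: lipschitz_onI)
  have "homeomorphism S (f ` S) f ?g"
    using inj lipschitz_on_continuous_on[OF L] lipschitz_on_continuous_on[OF g]
    by (intro homeomorphismI) auto
  then show ?thesis unfolding bi_lipschitz_embedding_on_def using L g by blast
qed

text \<open>Pushing only \<open>x\<close>, by the time difference \<open>\<tau>\<close>, gives
  \<open>D0\<close>, which the cone condition bounds below by \<open>\<delta> * \<tau>\<close>.
  Restoring the common time \<open>t\<close> changes it by at most
  \<open>e * L * norm (x - y)\<close>, which smallness of \<open>e\<close> absorbs.\<close>

lemma push_along_field_lower_bound:
  fixes V :: "'a::real_normed_vector \<Rightarrow> 'a"
  assumes V: "L-lipschitz_on K V" and M: "norm (V x) \<le> M"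
    and xy: "x \<in> K" "y \<in> K" and st: "0 \<le> t" "t \<le> s" "s \<le> e"
    and \<delta>: "0 < \<delta>"
    and cone: "\<And>w \<tau>. \<lbrakk>0 < \<tau>; \<tau> \<le> e; norm (w - V x) < \<delta>\<rbrakk> \<Longrightarrow> x + \<tau> *\<^sub>R w \<noteq> y"
    and e: "2 * (1 + (M + 1) / \<delta>) * (e * L) \<le> 1"
  shows "norm (x - y) + (s - t) \<le> 2 * (1 + (M + 1) / \<delta>) * norm (x + s *\<^sub>R V x - (y + t *\<^sub>R V y))"
proof -
  define \<tau> where "\<tau> = s - t"
  define D where "D = x + s *\<^sub>R V x - (y + t *\<^sub>R V y)"
  define D0 where "D0 = x + \<tau> *\<^sub>R V x - y"
  define k where "k = 1 + (M + 1) / \<delta>"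
  have tau: "0 \<le> \<tau>" "\<tau> \<le> e" using st by (auto simp: \<tau>_def)
  have M0: "0 \<le> M" using M norm_ge_zero order_trans by blast
  have k: "0 \<le> k" using M0 \<delta> by (simp add: k_def)
  have *: "\<delta> * \<tau> \<le> norm D0"
  proof (rule ccontr)
    assume neg: "\<not> ?thesis"
    then have pos: "0 < \<tau>" using tau by (cases "\<tau> = 0") auto
    \<comment> \<open>The direction that carries \<open>x\<close> exactly to \<open>y\<close> in
      time \<open>\<tau>\<close>; if \<open>D0\<close> were too short, it would lie in the
      cone.\<close>
    define w where "w = (1 / \<tau>) *\<^sub>R (y - x)"
    have "D0 = \<tau> *\<^sub>R (V x - w)" using pos by (simp add: D0_def w_def algebra_simps)
    then have "norm D0 = \<tau> * norm (w - V x)" using pos by (simp add: norm_minus_commute)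
    then have "norm (w - V x) < \<delta>" using neg pos by (simp add: mult.commute)
    moreover have "x + \<tau> *\<^sub>R w = y" using pos by (simp add: w_def)
    ultimately show False using cone pos tau by blast
  qed
  have "norm (x - y) \<le> norm D0 + \<tau> * M"
  proof -
    have "x - y = D0 - \<tau> *\<^sub>R V x" by (simp add: D0_def)
    then have "norm (x - y) \<le> norm D0 + \<tau> * norm (V x)"
      using norm_triangle_ineq4[of D0 "\<tau> *\<^sub>R V x"] tau by simp
    also have "\<dots> \<le> norm D0 + \<tau> * M" using M tau by (simp add: mult_left_mono)
    finally show ?thesis .
  qed
  \<comment> \<open>\<open>M\<close> pays for the displacement in the bound on
    \<open>norm (x - y)\<close>, and the extra 1 for the summand \<open>\<tau>\<close>.\<close>
  moreover have "\<tau> * (M + 1) \<le> norm D0 / \<delta> * (M + 1)"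
    using * \<delta> M0 by (intro mult_right_mono) (auto simp: field_simps)
  ultimately have D0: "norm (x - y) + \<tau> \<le> k * norm D0"
    by (simp add: k_def algebra_simps)
  have "norm D0 \<le> norm D + e * L * norm (x - y)"
  proof -
    have "D0 = D - t *\<^sub>R (V x - V y)" by (simp add: D0_def D_def \<tau>_def algebra_simps)
    then have "norm D0 \<le> norm D + t * norm (V x - V y)"
      using norm_triangle_ineq4[of D "t *\<^sub>R (V x - V y)"] st by simp
    moreover have "t * norm (V x - V y) \<le> e * (L * norm (x - y))"
      using lipschitz_onD[OF V xy] st by (intro mult_mono) (auto simp: dist_norm)
    ultimately show ?thesis by (simp add: mult.assoc)
  qed
  then have "k * norm D0 \<le> k * norm D + k * (e * L) * norm (x - y)"
    using mult_left_mono[OF _ k] by (fastforce simp: algebra_simps)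
  \<comment> \<open>The error is thus at most half of \<open>norm (x - y)\<close>; moving it to the
    left and doubling gives the factor 2.\<close>
  moreover have "2 * k * (e * L) * norm (x - y) \<le> 1 * norm (x - y)"
    using e unfolding k_def by (intro mult_right_mono) auto
  ultimately have "norm (x - y) + \<tau> \<le> 2 * k * norm D"
    using D0 tau by linarith
  then show ?thesis by (simp add: \<tau>_def D_def k_def)
qed

lemma push_along_field_bi_lipschitz:
  fixes U :: "'a::real_normed_vector set"
  assumes V: "L-lipschitz_on K V" and M: "\<And>x. x \<in> K \<Longrightarrow> norm (V x) \<le> M"
    and pos: "0 < \<delta>" "0 < \<rho>" and KU: "K \<inter> U = {}"
    and cone: "\<And>x t w. \<lbrakk>x \<in> K; 0 < t; t < \<rho>; norm (w - V x) < \<delta>\<rbrakk> \<Longrightarrow> x + t *\<^sub>R w \<in> U"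
  obtains e where "0 < e" "e < \<rho>"
    "bi_lipschitz_embedding_on (K \<times> {0..1}) (\<lambda>(x, t). x + (e * t) *\<^sub>R V x)"
proof (cases "K = {}")
  case True
  show ?thesis
  proof (rule that)
    show "0 < \<rho> / 2" "\<rho> / 2 < \<rho>" using pos by auto
    show "bi_lipschitz_embedding_on (K \<times> {0..1}) (\<lambda>(x, t). x + (\<rho> / 2 * t) *\<^sub>R V x)"
      using True by (intro bi_lipschitz_embedding_onI[of 0 _ _ 0]) auto
  qed
next
  case False
  \<comment> \<open>Nonnegativity of \<open>M\<close> comes from a point of \<open>K\<close>, which
    is why the empty set is treated apart.\<close>
  then have M0: "0 \<le> M" using M norm_ge_zero order_trans by blast
  have L0: "0 \<le> L" using V lipschitz_on_nonneg by blast
  define k where "k = 1 + (M + 1) / \<delta>"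
  have k: "0 < k" using M0 pos by (simp add: k_def add_pos_nonneg)
  \<comment> \<open>The bound 1 serves to compare distances in the product,
    \<open>\<rho> / 2\<close> keeps steps in the range of the cone condition, and the last bound
    absorbs the variation of \<open>V\<close>; \<open>L + 1\<close> avoids division by zero.\<close>
  define e where "e = min (min 1 (\<rho> / 2)) (1 / (2 * k * (L + 1)))"
  have e: "0 < e" "e \<le> 1" "e < \<rho>" using pos k L0 by (auto simp: e_def)
  have eL: "2 * k * (e * L) \<le> 1"
  proof -
    have "2 * k * (e * L) \<le> (2 * k * (L + 1)) * e" using e k L0 by (simp add: algebra_simps)
    also have "\<dots> \<le> (2 * k * (L + 1)) * (1 / (2 * k * (L + 1)))"
      using k L0 by (intro mult_left_mono) (auto simp: e_def)
    also have "\<dots> = 1" using k L0 by simp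
    finally show ?thesis .
  qed
  let ?\<Psi> = "\<lambda>(x, t). x + (e * t) *\<^sub>R V x"
  have lower1: "dist (x, s) (y, t) \<le> 2 * k / e * dist (?\<Psi> (x, s)) (?\<Psi> (y, t))"
    if xy: "x \<in> K" "y \<in> K" and st: "0 \<le> t" "t \<le> s" "s \<le> 1" for x y and s t :: real
  proof -
    have "norm (x - y) + (e * s - e * t)
        \<le> 2 * (1 + (M + 1) / \<delta>) * norm (x + (e * s) *\<^sub>R V x - (y + (e * t) *\<^sub>R V y))"
    proof (rule push_along_field_lower_bound[OF V M[OF xy(1)] xy])
      show "0 \<le> e * t" "e * t \<le> e * s" "e * s \<le> e" using st e by (auto intro: mult_left_mono)
      show "0 < \<delta>" by fact
      show "x + \<tau> *\<^sub>R w \<noteq> y" if "0 < \<tau>" "\<tau> \<le> e" "norm (w - V x) < \<delta>" for w \<tau>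
        using cone[of x \<tau> w] that xy KU e by auto
      show "2 * (1 + (M + 1) / \<delta>) * (e * L) \<le> 1" using eL by (simp add: k_def)
    qed
    then have main: "norm (x - y) + e * (s - t) \<le> 2 * k * dist (?\<Psi> (x, s)) (?\<Psi> (y, t))"
      by (simp add: k_def dist_norm algebra_simps)
    have "dist (x, s) (y, t) \<le> dist x y + dist s t"
      unfolding dist_prod_def by (simp add: sqrt_sum_squares_le_sum)
    also have "\<dots> = norm (x - y) + (s - t)" using st by (simp add: dist_norm)
    finally have "e * dist (x, s) (y, t) \<le> e * (norm (x - y) + (s - t))"
      using e by (simp add: mult_left_mono)
    also have "\<dots> \<le> norm (x - y) + e * (s - t)"
      using e mult_left_le_one_le[of "norm (x - y)" e] by (simp add: distrib_left)
    finally have "e * dist (x, s) (y, t) \<le> 2 * k * dist (?\<Psi> (x, s)) (?\<Psi> (y, t))"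
      using main by linarith
    then show ?thesis using e by (simp add: field_simps)
  qed
  have lower: "dist a b \<le> 2 * k / e * dist (?\<Psi> a) (?\<Psi> b)"
    if ab: "a \<in> K \<times> {0..1::real}" "b \<in> K \<times> {0..1}" for a b :: "'a \<times> real"
  proof (cases "snd b \<le> snd a")
    case True
    then show ?thesis using lower1[of "fst a" "fst b" "snd b" "snd a"] ab by auto
  next
    case False
    then show ?thesis using lower1[of "fst b" "fst a" "snd a" "snd b"] ab
      by (auto simp: dist_commute)
  qed
  have "(1 + L + M)-lipschitz_on (K \<times> {0..1}) ?\<Psi>"
  proof (rule lipschitz_onI)
    fix a b :: "'a \<times> real" assume ab: "a \<in> K \<times> {0..1}" "b \<in> K \<times> {0..1}"
    obtain x s y t where [simp]: "a = (x, s)" "b = (y, t)" by fastforce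
    have *: "x \<in> K" "y \<in> K" "0 \<le> s" "s \<le> 1" "0 \<le> t" "t \<le> 1" using ab by auto
    have es: "0 \<le> e * s" "e * s \<le> 1" using e * mult_le_one by auto
    \<comment> \<open>The difference splits into the change of base point, the change of field at
      time \<open>s\<close>, and the change of time at \<open>y\<close>.\<close>
    have "dist (?\<Psi> a) (?\<Psi> b) = norm ((x - y) + (e * s) *\<^sub>R (V x - V y) + (e * (s - t)) *\<^sub>R V y)"
      by (simp add: dist_norm algebra_simps)
    also have "\<dots> \<le> norm (x - y) + norm ((e * s) *\<^sub>R (V x - V y)) + norm ((e * (s - t)) *\<^sub>R V y)"
      by (intro norm_triangle_le add_mono order_refl)
    also have "norm ((e * s) *\<^sub>R (V x - V y)) \<le> 1 * (L * dist x y)"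
      unfolding norm_scaleR using es lipschitz_onD[OF V *(1,2)]
      by (intro mult_mono) (auto simp: dist_norm)
    also have "norm ((e * (s - t)) *\<^sub>R V y) \<le> dist s t * M"
      unfolding norm_scaleR using e M[OF *(2)]
      by (intro mult_mono) (auto simp: dist_real_def abs_mult mult_left_le_one_le)
    also have "norm (x - y) + 1 * (L * dist x y) + dist s t * M
        \<le> dist a b + 1 * (L * dist a b) + dist a b * M"
      using dist_fst_le[of a b] dist_snd_le[of a b] L0 M0
      by (intro add_mono mult_mono) (auto simp: dist_norm)
    finally show "dist (?\<Psi> a) (?\<Psi> b) \<le> (1 + L + M) * dist a b" by (simp add: algebra_simps)
  qed (use L0 M0 in simp)
  then have "bi_lipschitz_embedding_on (K \<times> {0..1}) ?\<Psi>"
    by (rule bi_lipschitz_embedding_onI[of _ _ _ "2 * k / e"]) (use lower k e in auto)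
  then show ?thesis using that e by blast
qed

section \<open>Inward directions from Lipschitz graphs\<close>

lemma norm_omit_coord_le: "norm (omit_coord k x) \<le> norm x"
  by (rule norm_le_componentwise_cart) (simp add: omit_coord_def)

lemma omit_coord_diff: "omit_coord k x - omit_coord k y = omit_coord k (x - y)"
  by (simp add: omit_coord_def vec_eq_iff)

lemma omit_coord_mem: "omit_coord k x \<in> coord_hyperplane k"
  by (simp add: omit_coord_def coord_hyperplane_def)

text \<open>In chart coordinates a step \<open>t *\<^sub>R w\<close> rises by at least
  \<open>t * (1 - \<delta>)\<close> and moves horizontally by at most \<open>t * \<delta>\<close>,
  over which the graph rises by at most \<open>L * t * \<delta>\<close>. So a point above the graph
  stays above it if \<open>L * \<delta> < 1 - \<delta>\<close>.\<close>

lemma lipschitz_boundary_inward: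
  fixes U :: "(real ^ 'n) set"
  assumes "lipschitz_boundary U" "p \<in> frontier U"
  shows "\<exists>v \<delta> \<rho>. 0 < \<delta> \<and> 0 < \<rho> \<and> inward_at U p v \<delta> \<rho>"
proof -
  obtain r T k \<gamma> L where r: "r > 0" and T: "orthogonal_transformation (T :: real ^ 'n \<Rightarrow> real ^ 'n)"
    and \<gamma>: "L-lipschitz_on (coord_hyperplane k) \<gamma>"
    and eq: "T ` U \<inter> cube (T p) r = {y. y $ k > \<gamma> (omit_coord k y)} \<inter> cube (T p) r"
    using assms(1)[unfolded lipschitz_boundary_def, rule_format, OF assms(2)] by (elim exE conjE)
  have lin: "linear T" using T orthogonal_transformation_linear by blast
  have norm_T: "norm (T x) = norm x" for x using T orthogonal_transformation_norm by blast
  have inj: "inj T" using T orthogonal_transformation_inj by blast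
  obtain v where v: "T v = axis k 1" using T orthogonal_transformation_surj by (metis surjD)
  have L0: "0 \<le> L" using \<gamma> lipschitz_on_nonneg by blast
  define \<delta> where "\<delta> = 1 / (L + 2)"
  have \<delta>: "0 < \<delta>" "\<delta> \<le> 1" and L\<delta>: "L * \<delta> < 1 - \<delta>" using L0 by (auto simp: \<delta>_def field_simps)
  \<comment> \<open>Directions have norm at most 2, so start and end of a step lie within
    \<open>3 * \<rho>\<close>, hence within \<open>r\<close>, of \<open>T p\<close>, and thus in the
    cube.\<close>
  define \<rho> where "\<rho> = r / 4"
  have "inward_at U p v \<delta> \<rho>"
  proof (rule inward_atI)
    fix z t w
    assume z: "z \<in> U" "dist z p < \<rho>" and t: "0 < t" "t < \<rho>" and w: "norm (w - v) < \<delta>"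
    have in_cube: "y \<in> cube (T p) r" if "norm (y - T p) \<le> r" for y
    proof -
      have "\<bar>y $ i - T p $ i\<bar> \<le> r" for i
        using component_le_norm_cart[of "y - T p" i] that by simp
      then show ?thesis by (simp add: cube_def)
    qed
    define y where "y = T z + t *\<^sub>R T w"
    have y: "y = T (z + t *\<^sub>R w)" using lin by (simp add: y_def linear_add linear_scale)
    have Tz: "norm (T z - T p) < \<rho>"
      using z(2) norm_T[of "z - p"] lin by (simp add: linear_diff dist_norm)
    have Tw: "norm (T w - axis k 1) < \<delta>"
      using w norm_T[of "w - v"] lin v by (simp add: linear_diff)
    have "norm (T w) \<le> norm (T w - axis k 1) + norm (axis k (1::real) :: real ^ 'n)"
      using norm_triangle_sub by (metis add.commute)
    then have "norm (T w) \<le> 2" using Tw \<delta> by (simp add: norm_axis_1)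
    then have "norm (t *\<^sub>R T w) \<le> \<rho> * 2" unfolding norm_scaleR using t by (intro mult_mono) auto
    then have "norm (y - T p) \<le> r"
      using norm_triangle_ineq[of "T z - T p" "t *\<^sub>R T w"] Tz r by (simp add: y_def \<rho>_def algebra_simps)
    then have ycube: "y \<in> cube (T p) r" by (rule in_cube)
    have "T z \<in> T ` U \<inter> cube (T p) r" using z Tz r by (auto intro!: in_cube simp: \<rho>_def)
    then have zk: "T z $ k > \<gamma> (omit_coord k (T z))" unfolding eq by simp
    \<comment> \<open>\<open>omit_coord k\<close> annihilates \<open>axis k 1\<close>, so only the
      deviation of \<open>T w\<close> from the axis contributes horizontally.\<close>
    have "omit_coord k y - omit_coord k (T z) = omit_coord k (t *\<^sub>R (T w - axis k 1))"
      by (simp add: omit_coord_diff y_def) (simp add: omit_coord_def vec_eq_iff axis_def)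
    then have "dist (omit_coord k y) (omit_coord k (T z)) \<le> norm (t *\<^sub>R (T w - axis k 1))"
      unfolding dist_norm using norm_omit_coord_le by metis
    also have "\<dots> \<le> t * \<delta>" using Tw t by simp
    finally have omit_le: "dist (omit_coord k y) (omit_coord k (T z)) \<le> t * \<delta>" .
    have "\<gamma> (omit_coord k y) - \<gamma> (omit_coord k (T z)) \<le> L * dist (omit_coord k y) (omit_coord k (T z))"
      using lipschitz_onD[OF \<gamma> omit_coord_mem omit_coord_mem, of y "T z"]
      by (simp add: dist_real_def abs_le_iff)
    also have "L * dist (omit_coord k y) (omit_coord k (T z)) \<le> L * (t * \<delta>)"
      using omit_le L0 by (rule mult_left_mono)
    also have "\<dots> = t * (L * \<delta>)" by simp
    also have "\<dots> < t * (1 - \<delta>)" using L\<delta> t by simp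
    also have "\<dots> \<le> t * (T w $ k)"
      using component_le_norm_cart[of "T w - axis k 1" k] Tw t by (simp add: axis_def)
    finally have "\<gamma> (omit_coord k y) < y $ k" using zk by (simp add: y_def)
    then have "y \<in> T ` U" using ycube eq by blast
    then show "z + t *\<^sub>R w \<in> U" using y inj by (simp add: inj_image_mem_iff)
  qed
  then show ?thesis using \<delta> r \<rho>_def by (intro exI[of _ v] exI[of _ \<delta>] exI[of _ \<rho>]) auto
qed

section \<open>The deformation of the boundary\<close>

theorem theorem8p3:
  fixes U :: "(real ^ 'n) set"
  assumes "lipschitz_domain U" and "bounded U"
  shows "deformable_lipschitz_boundary U"
proof -
  have U: "open U" and lb: "lipschitz_boundary U"
    using assms(1) by (auto simp: lipschitz_domain_def)
  have sub: "frontier U \<subseteq> closure U" by (simp add: frontier_def)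
  have disj: "frontier U \<inter> U = {}" using U by (auto simp: frontier_def interior_open)
  have "\<exists>\<Psi>. lipschitz_deformation U \<Psi>"
  proof (rule inward_field_exists[OF compact_frontier_bounded[OF assms(2)] sub
        lipschitz_boundary_inward[OF lb]])
    fix V :: "real ^ 'n \<Rightarrow> real ^ 'n" and L M \<delta> \<rho>
    assume V: "L-lipschitz_on (frontier U) V" "\<And>x. x \<in> frontier U \<Longrightarrow> norm (V x) \<le> M" "0 < \<delta>" "0 < \<rho>"
      and cone: "\<And>x t w. \<lbrakk>x \<in> frontier U; 0 < t; t < \<rho>; norm (w - V x) < \<delta>\<rbrakk> \<Longrightarrow> x + t *\<^sub>R w \<in> U"
    show ?thesis
    proof (rule push_along_field_bi_lipschitz[OF V disj cone])
      fix e
      assume e: "0 < e" "e < \<rho>"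
        and bl: "bi_lipschitz_embedding_on (frontier U \<times> {0..1}) (\<lambda>(x, t). x + (e * t) *\<^sub>R V x)"
      have "x + (e * t) *\<^sub>R V x \<in> closure U" if x: "x \<in> frontier U" and t: "0 \<le> t" "t \<le> 1" for x t
      \<comment> \<open>The cone condition covers positive times only; at time 0 the point is still
        on the frontier.\<close>
      proof (cases "t = 0")
        case True
        then show ?thesis using x sub by auto
      next
        case False
        have "e * t \<le> e" using e t by (simp add: mult_left_le)
        then have "e * t < \<rho>" using e(2) by (rule order_le_less_trans)
        moreover have "0 < e * t" using e t False by simp
        ultimately have "x + (e * t) *\<^sub>R V x \<in> U" using V(3) by (intro cone x) auto
        then show ?thesis using closure_subset by blast
      qed
      then have "lipschitz_deformation U (\<lambda>(x, t). x + (e * t) *\<^sub>R V x)"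
        using bl by (auto simp: lipschitz_deformation_def)
      then show ?thesis by blast
    qed
  qed
  then show ?thesis using lb by (simp add: deformable_lipschitz_boundary_def)
qed

end
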